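(* Let $G$ be a simple mixed graph on $n$ vertices, let $a$ be an arc of $G$, and let $H=G-a$ be the mixed graph obtained by deleting the arc $a$. Then $0=\boldsymbol{\nu}_{2n}(H)=\boldsymbol{\nu}_{2n}(G)\leq\boldsymbol{\nu}_{2n-1}(H)\leq\boldsymbol{\nu}_{2n-1}(G)\leq\cdots\leq\boldsymbol{\nu}_{2}(G)\leq\boldsymbol{\nu}_{1}(H)\leq\boldsymbol{\nu}_{1}(G)$, i.e. $\boldsymbol{\nu}_{i+1}(G)\le \boldsymbol{\nu}_i(H)\le \boldsymbol{\nu}_i(G)$ for all $i$, where $\boldsymbol{\nu}_1(\cdot)\geq\cdots\geq\boldsymbol{\nu}_{2n}(\cdot)$ denote the eigenvalues of the integrated Laplacian matrix.
   Context: A mixed graph $G=(V_G,E_G,\vec{E}_G)$ has a finite vertex set, a multiset $E_G$ of unordered pairs (edges; $\{v,v\}$ is a loop) and a multiset $\vec{E}_G$ of ordered pairs (arcs; $(v,v)$ is a directed loop). It is simple if it has no loops, no directed loops, no multiple edges and no multiple arcs. $d(v)$ is the number of edges incident with $v$; $d^+(v)$ (resp. $d^-(v)$) is the number of arcs starting (resp. ending) at $v$. For $V_G=\{v_1,\dots,v_n\}$ the integrated adjacency matrix $\mathcal{I}(G)$ is the $2n\times 2n$ matrix indexed by $v'_1,\dots,v'_n,v''_1,\dots,v''_n$ whose $(v'_i,v'_j)$ and $(v''_i,v''_j)$ entries ($i\ne j$) are the number of edges joining $v_i,v_j$, whose diagonal entries are $2\times$(number of loops at $v_i$), and whose $(v'_i,v''_j)$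 and $(v''_j,v'_i)$ entries are the number of arcs from $v_i$ to $v_j$. The integrated degree matrix $\mathcal{I}^D(G)$ is diagonal with $(v'_i,v'_i)$ entry $d(v_i)+d^+(v_i)$ and $(v''_i,v''_i)$ entry $d(v_i)+d^-(v_i)$, and the integrated Laplacian matrix is $\mathcal{I}^L(G)=\mathcal{I}^D(G)-\mathcal{I}(G)$. *)

theory Defs
  imports
    "HOL-Library.Multiset"
    "HOL-Library.Uprod"
    "HOL-Computational_Algebra.Polynomial"
    "Jordan_Normal_Form.Char_Poly"
begin

section \<open>Mixed graphs\<close>

text \<open>An edge is an unordered pair, with \<^term>\<open>Upair v v\<close> a loop; an arc \<open>(u, v)\<close> starts at
  \<open>u\<close> and ends at \<open>v\<close>.\<close>

record 'a mixed_graph =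
  verts :: "'a set"
  edges :: "'a uprod multiset"
  arcs :: "('a \<times> 'a) multiset"

definition wf_mixed_graph :: "'a mixed_graph \<Rightarrow> bool" where
  "wf_mixed_graph G \<longleftrightarrow>
     finite (verts G) \<and>
     (\<forall>e \<in># edges G. set_uprod e \<subseteq> verts G) \<and>
     (\<forall>a \<in># arcs G. fst a \<in> verts G \<and> snd a \<in> verts G)"

definition simple_mixed_graph :: "'a mixed_graph \<Rightarrow> bool" where
  "simple_mixed_graph G \<longleftrightarrow>
     wf_mixed_graph G \<and>
     (\<forall>v. Upair v v \<notin># edges G) \<and>
     (\<forall>v. (v, v) \<notin># arcs G) \<and>
     (\<forall>e. count (edges G) e \<le> 1) \<and>
     (\<forall>a. count (arcs G) a \<le> 1)"

definition del_arc :: "'a mixed_graph \<Rightarrow> 'a \<times> 'a \<Rightarrow> 'a mixed_graph" where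
  "del_arc G a = G\<lparr>arcs := arcs G - {#a#}\<rparr>"

definition deg :: "'a mixed_graph \<Rightarrow> 'a \<Rightarrow> nat" where
  "deg G v = size {#e \<in># edges G. v \<in> set_uprod e#}"

definition out_deg :: "'a mixed_graph \<Rightarrow> 'a \<Rightarrow> nat" where
  "out_deg G v = size {#a \<in># arcs G. fst a = v#}"

definition in_deg :: "'a mixed_graph \<Rightarrow> 'a \<Rightarrow> nat" where
  "in_deg G v = size {#a \<in># arcs G. snd a = v#}"


section \<open>Integrated matrices\<close>

text \<open>The list \<open>vs\<close> enumerates the vertices as \<open>v\<^sub>1, \<dots>, v\<^sub>n\<close>. Matrix indices count from \<open>0\<close>:
  with \<open>n = length vs\<close> and \<open>i < n\<close>, index \<open>i\<close> is the primed and \<open>n + i\<close> the doubly primed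
  copy of the vertex \<open>vs ! i\<close>.\<close>

definition edge_mat :: "'a list \<Rightarrow> 'a mixed_graph \<Rightarrow> real mat" where
  "edge_mat vs G = mat (length vs) (length vs) (\<lambda>(i, j).
     if i = j then 2 * real (count (edges G) (Upair (vs ! i) (vs ! i)))
     else real (count (edges G) (Upair (vs ! i) (vs ! j))))"

definition arc_mat :: "'a list \<Rightarrow> 'a mixed_graph \<Rightarrow> real mat" where
  "arc_mat vs G = mat (length vs) (length vs) (\<lambda>(i, j).
     real (count (arcs G) (vs ! i, vs ! j)))"

definition integrated_adjacency :: "'a list \<Rightarrow> 'a mixed_graph \<Rightarrow> real mat" where
  "integrated_adjacency vs G =
     four_block_mat (edge_mat vs G) (arc_mat vs G)
       (transpose_mat (arc_mat vs G)) (edge_mat vs G)"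

definition integrated_degree :: "'a list \<Rightarrow> 'a mixed_graph \<Rightarrow> real mat" where
  "integrated_degree vs G =
     (let n = length vs in
      four_block_mat
        (mat_diag n (\<lambda>i. real (deg G (vs ! i) + out_deg G (vs ! i)))) (0\<^sub>m n n)
        (0\<^sub>m n n) (mat_diag n (\<lambda>i. real (deg G (vs ! i) + in_deg G (vs ! i)))))"

definition integrated_laplacian :: "'a list \<Rightarrow> 'a mixed_graph \<Rightarrow> real mat" where
  "integrated_laplacian vs G = integrated_degree vs G - integrated_adjacency vs G"


section \<open>Ordered eigenvalues\<close>

text \<open>The real eigenvalues of a matrix with algebraic multiplicity, in decreasing order.\<close>

definition eigenvalues_desc :: "real mat \<Rightarrow> real list" where
  "eigenvalues_desc A = rev (sorted_list_of_multiset (proots (char_poly A)))"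

text \<open>Eigenvalues are numbered from \<open>1\<close>, so \<open>\<nu>\<^sub>1\<close> is the largest.\<close>

definition nu :: "'a list \<Rightarrow> 'a mixed_graph \<Rightarrow> nat \<Rightarrow> real" where
  "nu vs G i = eigenvalues_desc (integrated_laplacian vs G) ! (i - 1)"

text \<open>A real symmetric matrix has all its eigenvalues real, so for such a matrix
  \<^const>\<open>eigenvalues_desc\<close> is the complete spectrum and \<open>\<nu>\<^sub>1, \<dots>, \<nu>\<^sub>2\<^sub>n\<close> are all proper
  list entries.\<close>

lemma symmetric_eigenvalue_real:
  fixes A :: "real mat"
  assumes A: "A \<in> carrier_mat n n" and sym: "transpose_mat A = A"
    and ev: "eigenvalue (map_mat complex_of_real A) z"
  shows "z \<in> \<real>"
proof -
  define C where "C = map_mat complex_of_real A"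
  have C: "C \<in> carrier_mat n n" using A by (simp add: C_def)
  obtain v where v: "v \<in> carrier_vec n" "v \<noteq> 0\<^sub>v n" and Cv: "C *\<^sub>v v = z \<cdot>\<^sub>v v"
    using ev C unfolding eigenvalue_def eigenvector_def C_def[symmetric] by auto
  have entry: "A $$ (i, j) = A $$ (j, i)" if "i < n" "j < n" for i j
    using arg_cong[OF sym, of "\<lambda>M. M $$ (i, j)"] A that by simp
  have mv: "(C *\<^sub>v v) $ i = (\<Sum>j<n. of_real (A $$ (i, j)) * v $ j)" if "i < n" for i
    using that A v by (simp add: C_def scalar_prod_def lessThan_atLeast0)
  define S where "S = (\<Sum>i<n. \<Sum>j<n. of_real (A $$ (i, j)) * v $ j * cnj (v $ i))"
  define N where "N = (\<Sum>i<n. (cmod (v $ i))\<^sup>2)"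
  have "S = (\<Sum>i<n. (C *\<^sub>v v) $ i * cnj (v $ i))"
    by (simp add: S_def mv sum_distrib_right)
  also have "\<dots> = (\<Sum>i<n. z * (v $ i * cnj (v $ i)))"
    using v by (simp add: Cv mult.assoc)
  also have "\<dots> = z * of_real N"
    by (simp add: N_def sum_distrib_left complex_norm_square del: of_real_power)
  finally have S: "S = z * of_real N" .
  have "cnj S = (\<Sum>i<n. \<Sum>j<n. of_real (A $$ (i, j)) * v $ i * cnj (v $ j))"
    by (simp add: S_def cnj_sum mult_ac)
  also have "\<dots> = (\<Sum>j<n. \<Sum>i<n. of_real (A $$ (i, j)) * v $ i * cnj (v $ j))"
    by (rule sum.swap)
  also have "\<dots> = S"
    unfolding S_def by (intro sum.cong refl) (simp add: entry)
  finally have "cnj S = S" .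
  hence "(cnj z - z) * of_real N = 0"
    by (simp add: S algebra_simps)
  moreover have "N \<noteq> 0"
  proof
    assume "N = 0"
    hence "\<forall>i<n. v $ i = 0"
      unfolding N_def by (subst (asm) sum_nonneg_eq_0_iff) auto
    hence "v = 0\<^sub>v n" using v by (intro eq_vecI) auto
    with v show False by simp
  qed
  ultimately have "cnj z = z" by simp
  thus ?thesis by (simp add: Reals_cnj_iff)
qed

lemma length_eigenvalues_desc:
  fixes A :: "real mat"
  assumes A: "A \<in> carrier_mat n n" and sym: "transpose_mat A = A"
  shows "length (eigenvalues_desc A) = n"
proof -
  let ?C = "map_mat complex_of_real A"
  interpret c: map_poly_inj_idom_hom complex_of_real ..
  have C: "?C \<in> carrier_mat n n" using A by simp
  obtain as where as: "char_poly ?C = (\<Prod>a\<leftarrow>as. [:- a, 1:])" "length as = n"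
    using char_poly_factorized[OF C] by blast
  have "z \<in> \<real>" if "z \<in> set as" for z
  proof -
    have "poly (char_poly ?C) z = 0"
      unfolding as using that by (induction as) auto
    thus ?thesis
      using symmetric_eigenvalue_real[OF A sym] eigenvalue_root_char_poly[OF C] by blast
  qed
  hence re: "map (\<lambda>a. complex_of_real (Re a)) as = as"
    by (intro map_idI) (simp add: of_real_Re)
  have "map_poly complex_of_real (char_poly A) = char_poly ?C"
    by (rule of_real_hom.char_poly_hom[OF A, symmetric])
  also have "\<dots> = (\<Prod>a\<leftarrow>map (\<lambda>a. complex_of_real (Re a)) as. [:- a, 1:])"
    by (simp only: re as)
  also have "\<dots> = map_poly complex_of_real (\<Prod>a\<leftarrow>as. [:- Re a, 1:])"
    by (simp add: c.hom_prod_list o_def)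
  finally have "char_poly A = (\<Prod>a\<leftarrow>as. [:- Re a, 1:])"
    by simp
  moreover have "size (proots (\<Prod>a\<leftarrow>as. [:- Re a, 1:])) = length as" for as
  proof (induction as)
    case (Cons a as)
    have "(\<Prod>a\<leftarrow>as. [:- Re a, 1:]) \<noteq> 0" by (auto simp: prod_list_zero_iff)
    hence "proots ([:- Re a, 1:] * (\<Prod>a\<leftarrow>as. [:- Re a, 1:])) =
        {#Re a#} + proots (\<Prod>a\<leftarrow>as. [:- Re a, 1:])"
      by (subst proots_mult) auto
    with Cons show ?case by (simp del: mult_pCons_left)
  qed simp
  ultimately have "size (proots (char_poly A)) = n"
    using as by simp
  thus ?thesis
    by (metis eigenvalues_desc_def length_rev mset_sorted_list_of_multiset size_mset)
qed

lemma integrated_laplacian_carrier: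
  "integrated_laplacian vs G \<in> carrier_mat (2 * length vs) (2 * length vs)"
  by (rule carrier_matI)
     (simp_all add: integrated_laplacian_def integrated_degree_def integrated_adjacency_def
        edge_mat_def arc_mat_def mat_diag_def Let_def)

lemma transpose_integrated_laplacian:
  "transpose_mat (integrated_laplacian vs G) = integrated_laplacian vs G"
  by (rule eq_matI)
     (auto simp: integrated_laplacian_def integrated_degree_def integrated_adjacency_def
        edge_mat_def arc_mat_def mat_diag_def Let_def Upair_inject intro!: arg_cong[where f = "count _"])

lemma length_eigenvalues_integrated_laplacian:
  "length (eigenvalues_desc (integrated_laplacian vs G)) = 2 * length vs"
  by (rule length_eigenvalues_desc[OF integrated_laplacian_carrier transpose_integrated_laplacian])

end

theory Submission
  imports Defs
begin

text \<open>Deleting the arc \<open>(u, v)\<close> changes the integrated Laplacian by the positive semidefinite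
  rank-one matrix \<open>z z\<^sup>T\<close> with \<open>z = e\<^sub>u\<^sub>' - e\<^sub>v\<^sub>'\<^sub>'\<close>: the quadratic form drops by
  \<open>(z \<bullet> x)\<^sup>2\<close>, and not at all on the hyperplane orthogonal to \<open>z\<close>. Weyl's inequalities,
  obtained from orthonormal eigenbases by counting dimensions, give the interlacing. The integrated
  Laplacian has zero row sums and nonpositive off-diagonal entries, so it is positive semidefinite
  with the all-ones vector in its kernel, and its least eigenvalue is \<open>0\<close>.\<close>


section \<open>Splitting of the characteristic polynomial over the ordered eigenvalues\<close>

text \<open>Induction on the degree: dividing by a linear factor lowers both the degree and the
  number of roots by one, so their equality passes to the quotient and supplies a root as long as
  the degree is positive.\<close>

lemma prod_proots_eq:
  fixes p :: "'a :: idom poly"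
  assumes "p \<noteq> 0" and "size (proots p) = degree p"
  shows "p = Polynomial.smult (lead_coeff p) (\<Prod>x\<in>#proots p. [:- x, 1:])"
  using assms
proof (induction "degree p" arbitrary: p)
  case 0
  then have "proots p = {#}" by simp
  moreover obtain c where "p = [:c:]" using 0 degree_eq_zeroE by metis
  ultimately show ?case by simp
next
  case (Suc n)
  then obtain x where x: "x \<in># proots p"
    by (metis nat.simps(3) size_eq_0_iff_empty multiset_nonemptyE)
  then have "poly p x = 0" using Suc.prems by simp
  then obtain q where q: "p = [:- x, 1:] * q" by (metis poly_eq_0_iff_dvd dvdE)
  have q0: "q \<noteq> 0" using Suc.prems(1) q by auto
  have pr: "proots p = {#x#} + proots q"
    unfolding q using q0 by (subst proots_mult) auto
  have "degree p = Suc (degree q)"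
    unfolding q using q0 by (subst degree_mult_eq) auto
  with Suc pr q0 have IH: "q = Polynomial.smult (lead_coeff q) (\<Prod>x\<in>#proots q. [:- x, 1:])"
    by simp
  have "lead_coeff p = lead_coeff q" unfolding q by (simp add: lead_coeff_mult del: mult_pCons_left)
  then show ?case
    using trans[OF q arg_cong[OF IH, of "(*) [:- x, 1:]"]]
    unfolding pr image_mset_union prod_mset.union image_mset_single prod_mset_singleton
      Polynomial.mult_smult_right by metis
qed

text \<open>Symmetry gives the list \<open>n\<close> entries, so the real roots exhaust the monic
  characteristic polynomial of degree \<open>n\<close>.\<close>

lemma char_poly_eigenvalues_desc:
  assumes A: "A \<in> carrier_mat n n" and sym: "transpose_mat A = A"
  shows "char_poly A = (\<Prod>a\<leftarrow>eigenvalues_desc A. [:- a, 1:])"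
proof -
  have m: "mset (eigenvalues_desc A) = proots (char_poly A)"
    by (simp add: eigenvalues_desc_def)
  have "size (proots (char_poly A)) = n"
    using length_eigenvalues_desc[OF A sym] m by (metis size_mset)
  moreover have "degree (char_poly A) = n" "lead_coeff (char_poly A) = 1"
    using degree_monic_char_poly[OF A] by auto
  ultimately have "char_poly A = (\<Prod>x\<in>#proots (char_poly A). [:- x, 1:])"
    using prod_proots_eq[of "char_poly A"] by force
  also have "\<dots> = (\<Prod>a\<leftarrow>eigenvalues_desc A. [:- a, 1:])"
    by (simp flip: m prod_mset_prod_list)
  finally show ?thesis .
qed

lemma eigenvalues_desc_antimono:
  assumes "i \<le> j" and "j < length (eigenvalues_desc A)"
  shows "eigenvalues_desc A ! j \<le> eigenvalues_desc A ! i"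
  using assms sorted_rev_nth_mono[of "eigenvalues_desc A"] by (simp add: eigenvalues_desc_def)

section \<open>Orthogonal diagonalization of real symmetric matrices\<close>

lemma scalar_prod_self_pos:
  fixes x :: "real vec"
  assumes "x \<in> carrier_vec n" and "x \<noteq> 0\<^sub>v n"
  shows "0 < x \<bullet> x"
proof -
  have "x \<bullet> x \<noteq> 0"
  proof
    assume "x \<bullet> x = 0"
    then have "x = 0\<^sub>v n"
      using assms(1) by (intro eq_vecI) (auto simp: scalar_prod_def sum_nonneg_eq_0_iff)
    with assms(2) show False by simp
  qed
  moreover have "0 \<le> x \<bullet> x" by (auto simp: scalar_prod_def intro: sum_nonneg)
  ultimately show ?thesis by simp
qed

text \<open>The Householder reflection along \<open>v - e\<^sub>0\<close>; for \<open>v = e\<^sub>0\<close> the factor \<open>1 / (1 - v $ 0)\<close>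
  is \<open>0\<close> and the formula gives the identity.\<close>

lemma orthogonal_mat_with_first_col:
  fixes v :: "real vec"
  assumes v: "v \<in> carrier_vec (Suc m)" and unit: "v \<bullet> v = 1"
  obtains Q where "Q \<in> carrier_mat (Suc m) (Suc m)" "transpose_mat Q * Q = 1\<^sub>m (Suc m)" "col Q 0 = v"
proof -
  let ?n = "Suc m"
  define u where "u i = (if i = 0 then v $ 0 - 1 else v $ i)" for i
  define c where "c = 1 / (1 - v $ 0)"
  define Q where "Q = mat ?n ?n (\<lambda>(i, j). (if i = j then 1 else 0) - c * u i * u j)"
  have Q: "Q \<in> carrier_mat ?n ?n" by (simp add: Q_def)
  have vv: "(v $ 0)\<^sup>2 + (\<Sum>i<m. (v $ Suc i)\<^sup>2) = 1"
    using unit v by (simp add: scalar_prod_def atLeast0LessThan sum.lessThan_Suc_shift power2_eq_square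
        del: sum.lessThan_Suc)
  have uu: "(\<Sum>i<?n. (u i)\<^sup>2) = 2 * (1 - v $ 0)"
    using vv unfolding sum.lessThan_Suc_shift by (simp add: u_def power2_eq_square algebra_simps)
  \<comment> \<open>In \<open>transpose_mat Q * Q\<close> this identity cancels the terms with
    \<open>u i * u j\<close>, leaving the identity matrix.\<close>
  have cuu: "c * c * (\<Sum>i<?n. (u i)\<^sup>2) = 2 * c"
  proof (cases "v $ 0 = 1")
    case False
    then have "c * (1 - v $ 0) = 1" by (simp add: c_def)
    moreover have "c * c * (2 * (1 - v $ 0)) = 2 * c * (c * (1 - v $ 0))" by (simp only: mult_ac)
    ultimately show ?thesis unfolding uu by simp
  qed (simp add: uu c_def)
  have "transpose_mat Q * Q = 1\<^sub>m ?n"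
  proof (rule eq_matI)
    fix i j assume "i < dim_row (1\<^sub>m ?n :: real mat)" "j < dim_col (1\<^sub>m ?n :: real mat)"
    then have ij: "i < ?n" "j < ?n" by auto
    have "(transpose_mat Q * Q) $$ (i, j) = (\<Sum>k<?n. ((if k = i then 1 else 0) - c * u k * u i) *
        ((if k = j then 1 else 0) - c * u k * u j))"
      using ij by (simp add: Q_def scalar_prod_def atLeast0LessThan)
    also have "\<dots> = (\<Sum>k<?n. (if k = i then (if i = j then 1 else 0) - c * u i * u j else 0)
        - (if k = j then c * u i * u j else 0) + c * c * (u k)\<^sup>2 * (u i * u j))"
      by (intro sum.cong) (auto simp: power2_eq_square algebra_simps)
    also have "\<dots> = (if i = j then 1 else 0) - 2 * c * u i * u j
        + c * c * (\<Sum>k<?n. (u k)\<^sup>2) * (u i * u j)"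
      using ij by (simp add: sum.distrib sum_subtractf sum_distrib_left sum_distrib_right del: sum.lessThan_Suc)
    also have "\<dots> = (if i = j then 1 else 0)"
      unfolding cuu by simp
    finally show "(transpose_mat Q * Q) $$ (i, j) = 1\<^sub>m ?n $$ (i, j)" using ij by simp
  qed (simp_all add: Q_def)
  moreover have "col Q 0 = v"
  proof (rule eq_vecI)
    fix i assume "i < dim_vec v"
    then have i: "i < ?n" using v by simp
    \<comment> \<open>If the first entry of a unit vector is \<open>1\<close>, all others vanish, so
      \<open>v\<close> is the first column of the identity.\<close>
    have "v $ 0 = 1 \<Longrightarrow> i \<noteq> 0 \<Longrightarrow> v $ i = 0"
    proof -
      assume v0: "v $ 0 = 1" and "i \<noteq> 0"
      then obtain k where k: "i = Suc k" "k < m" using i not0_implies_Suc by auto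
      have "(\<Sum>i<m. (v $ Suc i)\<^sup>2) = 0" using vv v0 by simp
      then show "v $ i = 0" using k by (simp add: sum_nonneg_eq_0_iff)
    qed
    then show "col Q 0 $ i = v $ i"
      using i v by (cases "v $ 0 = 1") (auto simp: Q_def u_def c_def field_simps)
  qed (use v in \<open>simp add: Q_def\<close>)
  ultimately show thesis using Q that by blast
qed

text \<open>The spectral theorem by deflation: an orthogonal \<open>Q\<close> whose first column is
  a unit eigenvector for the head of \<open>es\<close> makes \<open>A\<close> block diagonal, and
  the remaining block is symmetric with the tail of \<open>es\<close> as roots. The diagonal keeps
  the order of \<open>es\<close>, so that sorted eigenvalues can be matched with columns of
  \<open>U\<close>.\<close>

lemma symmetric_diagonalization:
  fixes A :: "real mat"
  assumes A: "A \<in> carrier_mat n n" and sym: "transpose_mat A = A"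
    and cp: "char_poly A = (\<Prod>e\<leftarrow>es. [:- e, 1:])"
  shows "\<exists>U \<in> carrier_mat n n. transpose_mat U * U = 1\<^sub>m n \<and>
    A = U * mat_diag n ((!) es) * transpose_mat U"
  using assms
proof (induction es arbitrary: n A)
  case Nil
  then have "n = 0" using degree_monic_char_poly[OF Nil(1)] by simp
  then show ?case using Nil(1) by (intro bexI[of _ "1\<^sub>m 0"]) (auto intro!: eq_matI)
next
  case (Cons e es n A)
  have "poly (char_poly A) e = 0" using Cons(4) by simp
  then obtain w where w: "w \<in> carrier_vec n" "w \<noteq> 0\<^sub>v n" "A *\<^sub>v w = e \<cdot>\<^sub>v w"
    using eigenvalue_root_char_poly[OF Cons(2)] Cons(2)
    unfolding eigenvalue_def eigenvector_def by auto
  have "n \<noteq> 0" using w by (auto intro: eq_vecI)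
  then obtain m where n: "n = Suc m" using not0_implies_Suc by blast
  note A = Cons(2)[unfolded n]
  define r where "r = w \<bullet> w"
  have r: "r > 0" unfolding r_def by (rule scalar_prod_self_pos[OF w(1,2)])
  define v where "v = (1 / sqrt r) \<cdot>\<^sub>v w"
  have v: "v \<in> carrier_vec (Suc m)" using w n by (simp add: v_def)
  have "v \<bullet> v = 1" using w r by (simp add: v_def r_def[symmetric] field_simps)
  then obtain Q where Q: "Q \<in> carrier_mat (Suc m) (Suc m)"
    and QtQ: "transpose_mat Q * Q = 1\<^sub>m (Suc m)" and Q0: "col Q 0 = v"
    using orthogonal_mat_with_first_col[OF v] by blast
  have Qt: "transpose_mat Q \<in> carrier_mat (Suc m) (Suc m)" using Q by simp
  have QQt: "Q * transpose_mat Q = 1\<^sub>m (Suc m)"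
    by (rule mat_mult_left_right_inverse[OF Qt Q QtQ])
  have Av: "A *\<^sub>v v = e \<cdot>\<^sub>v v"
    using w A n by (simp add: v_def mult_mat_vec smult_smult_assoc mult.commute)
  define B where "B = transpose_mat Q * A * Q"
  have B: "B \<in> carrier_mat (Suc m) (Suc m)" using Q A by (simp add: B_def)
  have Bsym: "transpose_mat B = B"
    unfolding B_def using Q A Cons(3) n
    by (simp add: transpose_mult[of _ "Suc m" "Suc m" _ "Suc m"] assoc_mult_mat[of _ "Suc m" "Suc m" _ "Suc m" _ "Suc m"])
  have AB: "A = Q * B * transpose_mat Q"
  proof -
    have "Q * B * transpose_mat Q = (Q * transpose_mat Q) * A * (Q * transpose_mat Q)"
      unfolding B_def using Q A by (simp add: assoc_mult_mat[of _ "Suc m" "Suc m" _ "Suc m" _ "Suc m"])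
    then show ?thesis using A QQt by simp
  qed
  \<comment> \<open>The first column of \<open>B\<close> is \<open>transpose_mat Q\<close> applied
    to \<open>e\<close> times the first column of \<open>Q\<close>, that is \<open>e\<close> times
    the first unit vector; symmetry then clears the first row.\<close>
  have colB: "B $$ (i, 0) = (if i = 0 then e else 0)" if "i < Suc m" for i
  proof -
    have "col B 0 = transpose_mat Q *\<^sub>v (A *\<^sub>v v)"
      unfolding B_def using Q A Q0
      by (metis Qt assoc_mult_mat_vec col_carrier_vec col_mult2 mult_carrier_mat zero_less_Suc)
    also have "\<dots> = e \<cdot>\<^sub>v (transpose_mat Q *\<^sub>v col Q 0)"
      using Av Q Q0 v by (simp add: mult_mat_vec[OF Qt v])
    also have "transpose_mat Q *\<^sub>v col Q 0 = col (1\<^sub>m (Suc m)) 0"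
      using QtQ Q Qt by (metis col_mult2 zero_less_Suc)
    finally show ?thesis using B that by (metis carrier_matD(1,2) col_one index_col index_smult_vec(1) index_unit_vec(1,3) mult.right_neutral mult_zero_right zero_less_Suc index_unit_vec(2))
  qed
  have rowB: "B $$ (0, i) = (if i = 0 then e else 0)" if "i < Suc m" for i
    using colB[OF that] B Bsym that by (metis carrier_matD index_transpose_mat(1) zero_less_Suc)
  define C where "C = mat m m (\<lambda>(i, j). B $$ (Suc i, Suc j))"
  have C: "C \<in> carrier_mat m m" by (simp add: C_def)
  define E where "E = mat 1 1 (\<lambda>_. e)"
  have E: "E \<in> carrier_mat 1 1" by (simp add: E_def)
  have BC: "B = four_block_mat E (0\<^sub>m 1 m) (0\<^sub>m m 1) C"
    using B by (intro eq_matI) (auto simp: E_def C_def colB rowB)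
  have Csym: "transpose_mat C = C"
  proof (rule eq_matI)
    fix i j assume "i < dim_row C" "j < dim_col C"
    then have "i < m" "j < m" by (simp_all add: C_def)
    then show "transpose_mat C $$ (i, j) = C $$ (i, j)"
      using arg_cong[OF Bsym, of "\<lambda>M. M $$ (Suc i, Suc j)"] B by (simp add: C_def)
  qed (simp_all add: C_def)
  have "char_poly A = char_poly B"
    by (rule char_poly_similar, rule similar_matI[of _ _ Q "transpose_mat Q" "Suc m"])
      (use A B Q QtQ QQt AB in auto)
  also have "\<dots> = char_poly E * char_poly C"
    unfolding BC by (rule char_poly_four_block_zeros_col[OF E _ C]) simp
  also have "char_poly E = [:- e, 1:]"
    by (simp add: char_poly_defs E_def det_single)
  finally have "char_poly C = (\<Prod>e\<leftarrow>es. [:- e, 1:])"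
    using Cons(4) by (simp del: mult_pCons_left)
  from Cons(1)[OF C Csym this] obtain V where V: "V \<in> carrier_mat m m"
    and VtV: "transpose_mat V * V = 1\<^sub>m m" and CV: "C = V * mat_diag m ((!) es) * transpose_mat V"
    by blast
  \<comment> \<open>\<open>W\<close> acts as \<open>V\<close> on the lower block and fixes the first
    coordinate, so \<open>Q * W\<close> diagonalizes \<open>A\<close>.\<close>
  define W where "W = four_block_mat (1\<^sub>m 1) (0\<^sub>m 1 m) (0\<^sub>m m 1) V"
  have W: "W \<in> carrier_mat (Suc m) (Suc m)"
    using V unfolding W_def by (metis four_block_carrier_mat one_carrier_mat plus_1_eq_Suc)
  have Wt: "transpose_mat W = four_block_mat (1\<^sub>m 1) (0\<^sub>m 1 m) (0\<^sub>m m 1) (transpose_mat V)"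
    unfolding W_def using V by (subst transpose_four_block_mat) auto
  have D: "mat_diag (Suc m) ((!) (e # es)) = four_block_mat E (0\<^sub>m 1 m) (0\<^sub>m m 1) (mat_diag m ((!) es))"
    by (rule eq_matI) (auto simp: mat_diag_def E_def nth_Cons')
  have one: "four_block_mat (1\<^sub>m 1) (0\<^sub>m 1 m) (0\<^sub>m m 1) (1\<^sub>m m) = (1\<^sub>m (Suc m) :: real mat)"
    by (rule eq_matI) auto
  have WtW: "transpose_mat W * W = 1\<^sub>m (Suc m)"
    unfolding Wt using V VtV unfolding W_def
    by (subst mult_four_block_mat[of _ 1 1 _ m _ m]) (auto simp: one)
  have BW: "B = W * mat_diag (Suc m) ((!) (e # es)) * transpose_mat W"
  proof -
    let ?d = "mat_diag m ((!) es)"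
    have d: "?d \<in> carrier_mat m m" by simp
    have VT: "transpose_mat V \<in> carrier_mat m m" using V by simp
    have "W * mat_diag (Suc m) ((!) (e # es)) = four_block_mat E (0\<^sub>m 1 m) (0\<^sub>m m 1) (V * ?d)"
      unfolding D W_def
      by (subst mult_four_block_mat[OF one_carrier_mat zero_carrier_mat zero_carrier_mat V
            E zero_carrier_mat zero_carrier_mat d])
        (simp add: left_mult_zero_mat[OF E] right_mult_zero_mat[OF V] left_mult_zero_mat[OF d]
          right_mult_zero_mat[OF one_carrier_mat] left_mult_one_mat[OF E] mult_carrier_mat[OF V d] E[simplified]
          left_add_zero_mat[OF mult_carrier_mat[OF V d]] right_add_zero_mat[OF E] del: One_nat_def)
    moreover have "four_block_mat E (0\<^sub>m 1 m) (0\<^sub>m m 1) (V * ?d) * transpose_mat W = B"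
      unfolding Wt BC CV
      by (subst mult_four_block_mat[OF E zero_carrier_mat zero_carrier_mat mult_carrier_mat[OF V d]
            one_carrier_mat zero_carrier_mat zero_carrier_mat VT])
        (simp add: right_mult_zero_mat[OF E] right_mult_one_mat[OF E] left_mult_zero_mat[OF VT]
          right_mult_zero_mat[OF mult_carrier_mat[OF V d]] right_add_zero_mat[OF E]
          left_mult_zero_mat[OF one_carrier_mat]
          left_add_zero_mat[OF mult_carrier_mat[OF mult_carrier_mat[OF V d] VT]] del: One_nat_def)
    ultimately show ?thesis by simp
  qed
  let ?D = "mat_diag (Suc m) ((!) (e # es))"
  note assoc = assoc_mult_mat[of _ "Suc m" "Suc m" _ "Suc m" _ "Suc m"]
  have U: "Q * W \<in> carrier_mat (Suc m) (Suc m)" using Q W by simp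
  have Ut: "transpose_mat (Q * W) = transpose_mat W * transpose_mat Q"
    using Q W by (rule transpose_mult)
  have "transpose_mat (Q * W) * (Q * W) = transpose_mat W * ((transpose_mat Q * Q) * W)"
    unfolding Ut using Q W by (simp add: assoc)
  also have "\<dots> = 1\<^sub>m (Suc m)" using QtQ WtW W by simp
  finally have "transpose_mat (Q * W) * (Q * W) = 1\<^sub>m (Suc m)" .
  moreover have "A = (Q * W) * ?D * transpose_mat (Q * W)"
  proof -
    have Wt': "transpose_mat W \<in> carrier_mat (Suc m) (Suc m)" using W by simp
    note WD = mult_carrier_mat[OF W mat_diag_dim[of "Suc m" "(!) (e # es)"]]
    have "A = Q * (W * ?D) * transpose_mat W * transpose_mat Q"
      unfolding AB BW by (simp only: assoc_mult_mat[OF Q WD Wt'])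
    also have "\<dots> = Q * (W * ?D) * transpose_mat (Q * W)"
      unfolding Ut by (rule assoc_mult_mat[OF mult_carrier_mat[OF Q WD] Wt' Qt])
    also have "Q * (W * ?D) = Q * W * ?D"
      by (rule assoc_mult_mat[OF Q W mat_diag_dim, symmetric])
    finally show ?thesis .
  qed
  ultimately show ?case using U n by blast
qed

section \<open>Dimension count and Weyl's inequalities\<close>

text \<open>Taken as rows and padded with zero rows, fewer than \<open>n\<close> vectors form a
  singular square matrix, which has a nonzero kernel vector.\<close>

lemma exists_orthogonal_vec:
  fixes vs :: "real vec list"
  assumes vs: "set vs \<subseteq> carrier_vec n" and len: "length vs < n"
  shows "\<exists>x \<in> carrier_vec n. x \<noteq> 0\<^sub>v n \<and> (\<forall>v \<in> set vs. v \<bullet> x = 0)"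
proof -
  let ?c = "\<lambda>i. if i < length vs then vs ! i else 0\<^sub>v n"
  \<comment> \<open>Since \<open>length vs < n\<close>, row \<open>n - 1\<close> carries none of the
    vectors; writing it as zero explicitly makes the determinant vanish.\<close>
  let ?M = "mat\<^sub>r n n (\<lambda>i. if i = n - 1 then 0\<^sub>v n else ?c i)"
  have "det ?M = 0"
    using vs len by (intro det_row_0) (auto simp: subset_iff)
  then obtain x where x: "x \<in> carrier_vec n" "x \<noteq> 0\<^sub>v n" "?M *\<^sub>v x = 0\<^sub>v n"
    using det_0_iff_vec_prod_zero[of ?M n] by auto
  have "vs ! i \<bullet> x = 0" if i: "i < length vs" for i
  proof -
    have "(?M *\<^sub>v x) $ i = 0" using x(3) i len by simp
    moreover have "row ?M i = vs ! i" using i len vs by (subst row_mat_of_row_fun) (auto simp: subset_iff)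
    ultimately show ?thesis using i len by simp
  qed
  then show ?thesis using x by (metis in_set_conv_nth)
qed

text \<open>In the coordinates \<open>y = transpose_mat U *\<^sub>v x\<close> the form is diagonal,
  and these coordinates are the products of \<open>x\<close> with the columns of
  \<open>U\<close>.\<close>

lemma quadratic_form_diagonalized:
  fixes U :: "real mat"
  assumes U: "U \<in> carrier_mat n n" and x: "x \<in> carrier_vec n"
  shows "x \<bullet> (U * mat_diag n f * transpose_mat U *\<^sub>v x) = (\<Sum>j<n. f j * (col U j \<bullet> x)\<^sup>2)"
proof -
  define y where "y = transpose_mat U *\<^sub>v x"
  have y: "y \<in> carrier_vec n" unfolding y_def using U x by (metis mult_mat_vec_carrier transpose_carrier_mat)
  have "x \<bullet> (U * mat_diag n f * transpose_mat U *\<^sub>v x) = x \<bullet> (U *\<^sub>v (mat_diag n f *\<^sub>v y))"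
    using U x y unfolding y_def
    by (simp add: assoc_mult_mat_vec[OF U mat_diag_dim y[unfolded y_def]] mult_carrier_mat[OF U mat_diag_dim]
        assoc_mult_mat_vec[OF mult_carrier_mat[OF U mat_diag_dim] transpose_carrier_mat[THEN iffD2, OF U] x])
  also have "\<dots> = y \<bullet> (mat_diag n f *\<^sub>v y)"
    unfolding y_def
    by (rule transpose_vec_mult_scalar[OF U mult_mat_vec_carrier[OF mat_diag_dim y[unfolded y_def]] x, symmetric])
  also have "\<dots> = (\<Sum>j<n. f j * (y $ j)\<^sup>2)"
  proof -
    have "(mat_diag n f *\<^sub>v y) $ j = f j * y $ j" if "j < n" for j
    proof -
      have "(mat_diag n f *\<^sub>v y) $ j = (\<Sum>k<n. (if j = k then f k else 0) * y $ k)"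
        using that carrier_vecD[OF y] by (simp add: mat_diag_def scalar_prod_def atLeast0LessThan)
      also have "\<dots> = (\<Sum>k<n. if j = k then f k * y $ k else 0)"
        by (intro sum.cong) auto
      finally show ?thesis using that by simp
    qed
    then show ?thesis
      using carrier_vecD[OF y] by (simp add: scalar_prod_def[of y] mat_diag_def atLeast0LessThan power2_eq_square mult_ac
          del: index_mult_mat_vec)
  qed
  finally show ?thesis using U by (simp add: y_def)
qed

text \<open>Parseval's identity, obtained from the diagonalized form with all weights
  \<open>1\<close>, where the matrix is \<open>U * transpose_mat U\<close>.\<close>

lemma sum_squared_col_orthogonal_mat:
  fixes U :: "real mat"
  assumes U: "U \<in> carrier_mat n n" and x: "x \<in> carrier_vec n" and o: "transpose_mat U * U = 1\<^sub>m n"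
  shows "(\<Sum>j<n. (col U j \<bullet> x)\<^sup>2) = x \<bullet> x"
proof -
  have "U * transpose_mat U = 1\<^sub>m n"
    by (rule mat_mult_left_right_inverse[OF _ U o]) (use U in simp)
  then show ?thesis
    using quadratic_form_diagonalized[OF U x, of "\<lambda>_. 1"] U x by simp
qed

text \<open>A nonzero vector orthogonal to \<open>zs\<close>, to the first \<open>i\<close> eigenvectors of \<open>B\<close> and to all but
  the first \<open>i + length zs + 1\<close> eigenvectors of \<open>A\<close> exists, as these are only \<open>n - 1\<close> conditions;
  it separates the two eigenvalues.\<close>

lemma eigenvalues_desc_interlace:
  fixes A B :: "real mat"
  assumes A: "A \<in> carrier_mat n n" "transpose_mat A = A"
    and B: "B \<in> carrier_mat n n" "transpose_mat B = B"
    and zs: "set zs \<subseteq> carrier_vec n"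
    and le: "\<And>x. x \<in> carrier_vec n \<Longrightarrow> \<forall>z \<in> set zs. z \<bullet> x = 0 \<Longrightarrow> x \<bullet> (A *\<^sub>v x) \<le> x \<bullet> (B *\<^sub>v x)"
    and i: "i + length zs < n"
  shows "eigenvalues_desc A ! (i + length zs) \<le> eigenvalues_desc B ! i"
proof -
  let ?k = "i + length zs" and ?a = "eigenvalues_desc A" and ?b = "eigenvalues_desc B"
  obtain U where U: "U \<in> carrier_mat n n" "transpose_mat U * U = 1\<^sub>m n"
    and AU: "A = U * mat_diag n ((!) ?a) * transpose_mat U"
    using symmetric_diagonalization[OF A char_poly_eigenvalues_desc[OF A]] by blast
  obtain V where V: "V \<in> carrier_mat n n" "transpose_mat V * V = 1\<^sub>m n"
    and BV: "B = V * mat_diag n ((!) ?b) * transpose_mat V"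
    using symmetric_diagonalization[OF B char_poly_eigenvalues_desc[OF B]] by blast
  let ?vs = "zs @ map (col V) [0..<i] @ map (col U) [Suc ?k..<n]"
  have "set ?vs \<subseteq> carrier_vec n" "length ?vs < n" using U V zs i by auto
  then obtain x where x: "x \<in> carrier_vec n" "x \<noteq> 0\<^sub>v n" and orth: "\<forall>v \<in> set ?vs. v \<bullet> x = 0"
    using exists_orthogonal_vec by blast
  have xx: "x \<bullet> x > 0" by (rule scalar_prod_self_pos[OF x])
  have "?a ! ?k * (x \<bullet> x) = (\<Sum>j<n. ?a ! ?k * (col U j \<bullet> x)\<^sup>2)"
    by (simp add: sum_squared_col_orthogonal_mat[OF U(1) x(1) U(2), symmetric] sum_distrib_left)
  \<comment> \<open>For \<open>j \<le> ?k\<close> the ordering of the eigenvalues decides; for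
    larger \<open>j\<close> both sides vanish, as \<open>x\<close> is orthogonal to
    \<open>col U j\<close>.\<close>
  also have "\<dots> \<le> (\<Sum>j<n. ?a ! j * (col U j \<bullet> x)\<^sup>2)"
  proof (rule sum_mono)
    fix j assume "j \<in> {..<n}"
    then show "?a ! ?k * (col U j \<bullet> x)\<^sup>2 \<le> ?a ! j * (col U j \<bullet> x)\<^sup>2"
      using orth i length_eigenvalues_desc[OF A]
      by (cases "j \<le> ?k") (auto intro!: mult_right_mono eigenvalues_desc_antimono)
  qed
  also have "\<dots> = x \<bullet> (A *\<^sub>v x)"
    using quadratic_form_diagonalized[OF U(1) x(1), of "(!) ?a"] by (simp flip: AU)
  also have "\<dots> \<le> x \<bullet> (B *\<^sub>v x)" using le[OF x(1)] orth by simp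
  also have "\<dots> = (\<Sum>j<n. ?b ! j * (col V j \<bullet> x)\<^sup>2)"
    using quadratic_form_diagonalized[OF V(1) x(1), of "(!) ?b"] by (simp flip: BV)
  \<comment> \<open>Here the terms with \<open>j < i\<close> vanish by orthogonality to
    \<open>col V j\<close>, and \<open>?b ! i\<close> is the largest of the remaining
    eigenvalues.\<close>
  also have "\<dots> \<le> (\<Sum>j<n. ?b ! i * (col V j \<bullet> x)\<^sup>2)"
  proof (rule sum_mono)
    fix j assume "j \<in> {..<n}"
    then show "?b ! j * (col V j \<bullet> x)\<^sup>2 \<le> ?b ! i * (col V j \<bullet> x)\<^sup>2"
      using orth i length_eigenvalues_desc[OF B]
      by (cases "i \<le> j") (auto intro!: mult_right_mono eigenvalues_desc_antimono)
  qed
  also have "\<dots> = ?b ! i * (x \<bullet> x)"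
    by (simp add: sum_squared_col_orthogonal_mat[OF V(1) x(1) V(2), symmetric] sum_distrib_left)
  finally show ?thesis using xx by simp
qed


section \<open>Rank-one updates and Laplacian-like matrices\<close>

lemma quadratic_form_eq_sum:
  fixes A :: "'a :: comm_semiring_0 mat"
  assumes "A \<in> carrier_mat n n" and "x \<in> carrier_vec n"
  shows "x \<bullet> (A *\<^sub>v x) = (\<Sum>i<n. \<Sum>j<n. A $$ (i, j) * (x $ i * x $ j))"
  using assms by (simp add: scalar_prod_def atLeast0LessThan sum_distrib_left mult_ac)

text \<open>The double sum contributed by the update factors into two copies of
  \<open>z \<bullet> x\<close>.\<close>

lemma quadratic_form_rank_one_update:
  fixes A B :: "'a :: comm_semiring_0 mat"
  assumes A: "A \<in> carrier_mat n n" and B: "B \<in> carrier_mat n n"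
    and z: "z \<in> carrier_vec n" and x: "x \<in> carrier_vec n"
    and AB: "\<And>i j. i < n \<Longrightarrow> j < n \<Longrightarrow> A $$ (i, j) = B $$ (i, j) + z $ i * z $ j"
  shows "x \<bullet> (A *\<^sub>v x) = x \<bullet> (B *\<^sub>v x) + (z \<bullet> x) * (z \<bullet> x)"
proof -
  have "x \<bullet> (A *\<^sub>v x) = (\<Sum>i<n. \<Sum>j<n. B $$ (i, j) * (x $ i * x $ j) + (z $ i * x $ i) * (z $ j * x $ j))"
    unfolding quadratic_form_eq_sum[OF A x]
    by (intro sum.cong refl) (simp add: AB algebra_simps)
  also have "\<dots> = x \<bullet> (B *\<^sub>v x) + (\<Sum>i<n. z $ i * x $ i) * (\<Sum>j<n. z $ j * x $ j)"
    by (simp add: sum.distrib quadratic_form_eq_sum[OF B x] sum_product)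
  finally show ?thesis using x by (simp add: scalar_prod_def atLeast0LessThan)
qed

text \<open>Such matrices are the Laplacians of graphs with nonnegative edge weights; the properties
  suffice for the least eigenvalue to be \<open>0\<close>.\<close>

locale laplacian_like =
  fixes A :: "real mat" and n :: nat
  assumes carrier: "A \<in> carrier_mat n n" and sym: "transpose_mat A = A"
    and row_sum: "\<And>i. i < n \<Longrightarrow> (\<Sum>j<n. A $$ (i, j)) = 0"
    and off_diag: "\<And>i j. i < n \<Longrightarrow> j < n \<Longrightarrow> i \<noteq> j \<Longrightarrow> A $$ (i, j) \<le> 0"
begin

text \<open>Row sums vanish, and by symmetry column sums too, so
  \<open>- 2 * (x \<bullet> (A *\<^sub>v x))\<close> is the sum of all
  \<open>A $$ (i, j) * (x $ i - x $ j)\<^sup>2\<close>. The diagonal terms are zero and the others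
  nonpositive.\<close>

lemma quadratic_form_nonneg:
  assumes x: "x \<in> carrier_vec n"
  shows "0 \<le> x \<bullet> (A *\<^sub>v x)"
proof -
  have swap: "A $$ (i, j) = A $$ (j, i)" if "i < n" "j < n" for i j
    using arg_cong[OF sym, of "\<lambda>M. M $$ (i, j)"] carrier that by simp
  have r: "(\<Sum>i<n. \<Sum>j<n. A $$ (i, j) * (x $ i)\<^sup>2) = 0"
    by (simp add: row_sum flip: sum_distrib_right)
  have "(\<Sum>i<n. \<Sum>j<n. A $$ (i, j) * (x $ j)\<^sup>2) = (\<Sum>j<n. \<Sum>i<n. A $$ (i, j) * (x $ j)\<^sup>2)"
    by (rule sum.swap)
  also have "\<dots> = (\<Sum>i<n. \<Sum>j<n. A $$ (i, j) * (x $ i)\<^sup>2)"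
    by (intro sum.cong refl) (simp add: swap)
  finally have c: "(\<Sum>i<n. \<Sum>j<n. A $$ (i, j) * (x $ j)\<^sup>2) = 0" using r by simp
  have "0 \<ge> (\<Sum>i<n. \<Sum>j<n. A $$ (i, j) * (x $ i - x $ j)\<^sup>2)"
  proof (intro sum_nonpos)
    fix i j assume "i \<in> {..<n}" "j \<in> {..<n}"
    then show "A $$ (i, j) * (x $ i - x $ j)\<^sup>2 \<le> 0"
      using off_diag[of i j] by (cases "i = j") (auto intro: mult_nonpos_nonneg)
  qed
  also have "(\<Sum>i<n. \<Sum>j<n. A $$ (i, j) * (x $ i - x $ j)\<^sup>2)
      = (\<Sum>i<n. \<Sum>j<n. A $$ (i, j) * (x $ i)\<^sup>2 + A $$ (i, j) * (x $ j)\<^sup>2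
          - 2 * (A $$ (i, j) * (x $ i * x $ j)))"
    by (intro sum.cong refl) (simp add: power2_eq_square algebra_simps)
  also have "\<dots> = - 2 * (x \<bullet> (A *\<^sub>v x))"
    by (simp add: sum.distrib sum_subtractf r c quadratic_form_eq_sum[OF carrier x] flip: sum_distrib_left)
  finally show ?thesis by simp
qed

lemma set_eigenvalues_desc: "set (eigenvalues_desc A) = {e. eigenvalue A e}"
proof -
  have "char_poly A \<noteq> 0" using degree_monic_char_poly[OF carrier] by auto
  then show ?thesis
    by (simp add: eigenvalues_desc_def eigenvalue_root_char_poly[OF carrier] set_sorted_list_of_multiset)
qed

text \<open>The all-ones vector puts \<open>0\<close> among the eigenvalues, so the last and
  smallest is at most \<open>0\<close>; the nonnegative form at one of its eigenvectors bounds it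
  from below.\<close>

lemma last_eigenvalue_eq_0:
  assumes "n > 0"
  shows "eigenvalues_desc A ! (n - 1) = 0"
proof (rule antisym)
  let ?v = "vec n (\<lambda>_. 1 :: real)"
  have len: "length (eigenvalues_desc A) = n" by (rule length_eigenvalues_desc[OF carrier sym])
  have "A *\<^sub>v ?v = 0\<^sub>v n"
    using carrier row_sum by (intro eq_vecI) (auto simp: scalar_prod_def atLeast0LessThan)
  moreover have "?v \<noteq> 0\<^sub>v n" using assms by (auto dest: arg_cong[of _ _ "\<lambda>v. v $ 0"])
  ultimately have "eigenvalue A 0"
    using carrier unfolding eigenvalue_def eigenvector_def by (intro exI[of _ ?v]) auto
  then obtain k where "k < n" "eigenvalues_desc A ! k = 0"
    using set_eigenvalues_desc len by (metis in_set_conv_nth mem_Collect_eq)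
  then show "eigenvalues_desc A ! (n - 1) \<le> 0"
    using eigenvalues_desc_antimono[of k "n - 1" A] len by simp
next
  let ?e = "eigenvalues_desc A ! (n - 1)"
  have "?e \<in> set (eigenvalues_desc A)"
    using assms length_eigenvalues_desc[OF carrier sym] by (intro nth_mem) simp
  then obtain w where w: "w \<in> carrier_vec n" "w \<noteq> 0\<^sub>v n" "A *\<^sub>v w = ?e \<cdot>\<^sub>v w"
    using set_eigenvalues_desc carrier unfolding eigenvalue_def eigenvector_def by auto
  then have "0 \<le> ?e * (w \<bullet> w)" using quadratic_form_nonneg[OF w(1)] by simp
  then show "0 \<le> ?e" using scalar_prod_self_pos[OF w(1,2)] by (simp add: zero_le_mult_iff)
qed

end

section \<open>Degrees and entries of the integrated Laplacian\<close>

text \<open>Common core of the three degree formulas: \<open>f\<close> runs without repetition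
  through values that satisfy \<open>P\<close> and include every such member of
  \<open>M\<close>.\<close>

lemma size_filter_mset_eq_sum_count:
  assumes "finite V" and "inj_on f V"
    and "\<And>e. e \<in># M \<Longrightarrow> P e \<Longrightarrow> e \<in> f ` V" and "\<And>w. w \<in> V \<Longrightarrow> P (f w)"
  shows "size (filter_mset P M) = (\<Sum>w\<in>V. count M (f w))"
proof -
  have "size (filter_mset P M) = (\<Sum>e\<in>f ` V. count (filter_mset P M) e)"
    unfolding size_multiset_overloaded_eq
    by (rule sum.mono_neutral_left) (use assms in \<open>auto simp: not_in_iff\<close>)
  also have "\<dots> = (\<Sum>w\<in>V. count M (f w))"
    using assms by (simp add: sum.reindex)
  finally show ?thesis .
qed

lemma deg_eq_sum_count:
  assumes G: "simple_mixed_graph G"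
  shows "deg G v = (\<Sum>w\<in>verts G. count (edges G) (Upair v w))"
  unfolding deg_def
proof (rule size_filter_mset_eq_sum_count)
  fix e assume e: "e \<in># edges G" "v \<in> set_uprod e"
  obtain u w where "e = Upair u w" using uprod_exhaust by blast
  moreover have "set_uprod e \<subseteq> verts G"
    using e G by (simp add: simple_mixed_graph_def wf_mixed_graph_def)
  ultimately show "e \<in> Upair v ` verts G"
    using e(2) by (auto simp: image_iff Upair_inject)
qed (use G in \<open>auto simp: simple_mixed_graph_def wf_mixed_graph_def inj_on_def Upair_inject\<close>)

lemma out_deg_eq_sum_count:
  assumes "simple_mixed_graph G"
  shows "out_deg G v = (\<Sum>w\<in>verts G. count (arcs G) (v, w))"
  unfolding out_deg_def using assms
  by (intro size_filter_mset_eq_sum_count)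
    (force simp: simple_mixed_graph_def wf_mixed_graph_def inj_on_def image_iff)+

lemma in_deg_eq_sum_count:
  assumes "simple_mixed_graph G"
  shows "in_deg G v = (\<Sum>w\<in>verts G. count (arcs G) (w, v))"
  unfolding in_deg_def using assms
  by (intro size_filter_mset_eq_sum_count)
    (force simp: simple_mixed_graph_def wf_mixed_graph_def inj_on_def image_iff)+

text \<open>One formula covers the four blocks: \<open>i mod n\<close> finds the vertex of which
  index \<open>i\<close> is a copy, and \<open>i < n\<close> tells whether the copy is primed or
  doubly primed.\<close>

lemma integrated_laplacian_index:
  assumes "i < 2 * length vs" and "j < 2 * length vs"
  shows "integrated_laplacian vs G $$ (i, j) =
    (let n = length vs; u = vs ! (i mod n); v = vs ! (j mod n) in
      (if i = j then real (deg G u + (if i < n then out_deg G u else in_deg G u)) else 0) -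
      (if i < n \<longleftrightarrow> j < n then (if i = j then 2 else 1) * real (count (edges G) (Upair u v))
       else real (count (arcs G) (if i < n then (u, v) else (v, u)))))"
proof -
  let ?n = "length vs"
  have "k mod ?n = (if k < ?n then k else k - ?n)" if "k < 2 * ?n" for k
    using that by (auto simp: le_mod_geq)
  note m = this[OF assms(1)] this[OF assms(2)]
  \<comment> \<open>Truncated subtraction is injective on the doubly primed indices, so the block
    diagonal is the diagonal of the whole matrix.\<close>
  have "i - ?n = j - ?n \<longleftrightarrow> i = j" if "\<not> i < ?n" "\<not> j < ?n"
    using that by linarith
  then show ?thesis
    using assms unfolding Let_def m
    by (cases "i < ?n"; cases "j < ?n"; cases "i = j")
      (simp_all add: integrated_laplacian_def integrated_degree_def integrated_adjacency_def
        edge_mat_def arc_mat_def mat_diag_def Let_def)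
qed

lemma simple_mixed_graph_del_arc:
  "simple_mixed_graph G \<Longrightarrow> simple_mixed_graph (del_arc G a)"
  unfolding simple_mixed_graph_def wf_mixed_graph_def del_arc_def
  by (auto simp: le_diff_conv intro: le_trans[OF _ le_SucI] dest: in_diffD)

text \<open>Along a row, one half subtracts the edges at the vertex and the other its outgoing or
  incoming arcs; together they cancel the degree on the diagonal.\<close>

lemma laplacian_like_integrated_laplacian:
  assumes G: "simple_mixed_graph G" and vs: "distinct vs" "set vs = verts G"
  shows "laplacian_like (integrated_laplacian vs G) (2 * length vs)"
proof
  let ?n = "length vs" and ?L = "integrated_laplacian vs G"
  have loop: "count (edges G) (Upair v v) = 0" for v
    using G by (simp add: simple_mixed_graph_def not_in_iff)
  have V: "(\<Sum>j<?n. g (vs ! j)) = (\<Sum>w\<in>verts G. g w)" for g :: "'a \<Rightarrow> nat"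
    using sum.reindex_bij_betw[OF bij_betw_nth[OF vs(1) refl refl], of g] vs(2)
    by simp
  show "(\<Sum>j<2 * ?n. ?L $$ (i, j)) = 0" if i: "i < 2 * ?n" for i
  proof -
    let ?u = "vs ! (i mod ?n)"
    have split: "(\<Sum>j<2 * ?n. f j) = (\<Sum>j<?n. f j) + (\<Sum>j<?n. f (?n + j))" for f :: "nat \<Rightarrow> real"
      using sum.atLeastLessThan_concat[of 0 ?n "2 * ?n" f] sum.shift_bounds_nat_ivl[of f 0 ?n ?n]
      by (simp add: atLeast0LessThan mult_2 add.commute)
    let ?d = "real (deg G ?u + (if i < ?n then out_deg G ?u else in_deg G ?u))"
    let ?e = "\<lambda>j. real (count (edges G) (Upair ?u (vs ! j)))"
    let ?a = "\<lambda>j. real (count (arcs G) (if i < ?n then (?u, vs ! j) else (vs ! j, ?u)))"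
    \<comment> \<open>Absence of loops removes the factor \<open>2\<close> on the diagonal.\<close>
    have "(\<Sum>j<2 * ?n. ?L $$ (i, j)) = (\<Sum>j<2 * ?n. (if i = j then ?d else 0)
        - (if i < ?n \<longleftrightarrow> j < ?n then ?e (j mod ?n) else ?a (j mod ?n)))"
      using i by (intro sum.cong refl) (auto simp: integrated_laplacian_index Let_def loop)
    also have "\<dots> = ?d - (\<Sum>j<2 * ?n. if i < ?n \<longleftrightarrow> j < ?n then ?e (j mod ?n) else ?a (j mod ?n))"
      using i by (simp add: sum_subtractf)
    also have "(\<Sum>j<2 * ?n. if i < ?n \<longleftrightarrow> j < ?n then ?e (j mod ?n) else ?a (j mod ?n))
        = (\<Sum>j<?n. ?e j) + (\<Sum>j<?n. ?a j)"
      unfolding split by (cases "i < ?n") (simp_all cong: sum.cong_simp)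
    also have "\<dots> = ?d"
      using V[of "\<lambda>w. count (edges G) (Upair ?u w)"] V[of "\<lambda>w. count (arcs G) (?u, w)"]
        V[of "\<lambda>w. count (arcs G) (w, ?u)"]
      by (cases "i < ?n") (simp_all add: deg_eq_sum_count[OF G] out_deg_eq_sum_count[OF G]
          in_deg_eq_sum_count[OF G] flip: of_nat_sum)
    finally show ?thesis by simp
  qed
  show "?L $$ (i, j) \<le> 0" if "i < 2 * ?n" "j < 2 * ?n" "i \<noteq> j" for i j
    using that by (simp add: integrated_laplacian_index Let_def)
qed (rule integrated_laplacian_carrier transpose_integrated_laplacian)+

section \<open>Deletion of an arc and the resulting interlacing\<close>

text \<open>An arc from u to v adds \<open>1\<close> to the diagonal entries of u' and v'' and
  \<open>-1\<close> to the two entries joining them, which are exactly the nonzero products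
  \<open>z $ i * z $ j\<close>.\<close>

lemma integrated_laplacian_del_arc:
  assumes vs: "distinct vs" and a: "a \<in># arcs G"
    and z: "z = vec (2 * length vs) (\<lambda>i. if i < length vs then of_bool (vs ! i = fst a)
      else - of_bool (vs ! (i - length vs) = snd a))"
    and ij: "i < 2 * length vs" "j < 2 * length vs"
  shows "integrated_laplacian vs G $$ (i, j) =
    integrated_laplacian vs (del_arc G a) $$ (i, j) + z $ i * z $ j"
proof -
  let ?H = "del_arc G a"
  have arcs: "arcs G = add_mset a (arcs ?H)" using a by (simp add: del_arc_def)
  have edges: "edges G = edges ?H" by (simp add: del_arc_def)
  have deg: "deg G v = deg ?H v" for v by (simp add: deg_def edges)
  have out: "out_deg G v = out_deg ?H v + of_bool (v = fst a)" for v by (simp add: out_deg_def arcs)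
  have "in": "in_deg G v = in_deg ?H v + of_bool (v = snd a)" for v by (simp add: in_deg_def arcs)
  have count: "count (arcs G) b = count (arcs ?H) b + of_bool (b = a)" for b
    by (simp add: arcs)
  let ?n = "length vs"
  have m: "k mod ?n = (if k < ?n then k else k - ?n)" if "k < 2 * ?n" for k
    using that by (auto simp: le_mod_geq)
  have z_nth: "z $ k = (if k < ?n then of_bool (vs ! (k mod ?n) = fst a) else - of_bool (vs ! (k mod ?n) = snd a))"
    if "k < 2 * ?n" for k
    using that by (simp add: z m)
  \<comment> \<open>Within one half, distinctness of \<open>vs\<close> makes
    \<open>z $ i * z $ j\<close> vanish off the diagonal.\<close>
  have same: "vs ! (i mod ?n) = vs ! (j mod ?n) \<longleftrightarrow> i = j" if "i < ?n \<longleftrightarrow> j < ?n"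
  proof -
    have "i mod ?n < ?n" "j mod ?n < ?n" "i mod ?n = j mod ?n \<longleftrightarrow> i = j"
      unfolding m[OF ij(1)] m[OF ij(2)] using that ij by (cases "i < ?n"; force)+
    then show ?thesis by (simp add: nth_eq_iff_index_eq[OF vs])
  qed
  show ?thesis
    unfolding integrated_laplacian_index[OF ij] z_nth[OF ij(1)] z_nth[OF ij(2)] Let_def deg out "in" count edges
    using same by (cases "i < ?n"; cases "j < ?n"; cases "i = j") (auto simp: prod_eq_iff)
qed

theorem theorem3p3:
  fixes G H :: "'a mixed_graph" and a :: "'a \<times> 'a" and vs :: "'a list" and n :: nat
  assumes "simple_mixed_graph G"
    and "card (verts G) = n"
    and "distinct vs" and "set vs = verts G"
    and "a \<in># arcs G"
    and "H = del_arc G a"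
  shows "nu vs H (2 * n) = 0 \<and> nu vs G (2 * n) = 0 \<and>
    (\<forall>i\<in>{1..2 * n}. nu vs H i \<le> nu vs G i) \<and>
    (\<forall>i\<in>{1..<2 * n}. nu vs G (i + 1) \<le> nu vs H i)"
proof -
  note G = assms(1) and vs = assms(3,4) and a = assms(5)
  let ?L = "integrated_laplacian vs"
  have n: "length vs = n" using assms distinct_card by metis
  have H: "simple_mixed_graph H" "set vs = verts H"
    using G vs assms(6) by (simp_all add: simple_mixed_graph_del_arc) (simp add: del_arc_def)
  have "fst a \<in> set vs" using G a vs by (auto simp: simple_mixed_graph_def wf_mixed_graph_def)
  \<comment> \<open>The eigenvalue lists are thus nonempty, and \<open>2 * n - 1\<close> is the
    index of their last entry.\<close>
  then have "n > 0" using n by auto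
  have zero: "nu vs G (2 * n) = 0" "nu vs H (2 * n) = 0"
    using laplacian_like.last_eigenvalue_eq_0[OF laplacian_like_integrated_laplacian[OF G vs]]
      laplacian_like.last_eigenvalue_eq_0[OF laplacian_like_integrated_laplacian[OF H(1) vs(1) H(2)]]
      \<open>n > 0\<close> by (simp_all add: nu_def n)
  define z :: "real vec" where "z = vec (2 * length vs)
    (\<lambda>i. if i < length vs then of_bool (vs ! i = fst a) else - of_bool (vs ! (i - length vs) = snd a))"
  have z: "z \<in> carrier_vec (2 * n)" by (simp add: z_def n)
  note L = integrated_laplacian_carrier[of vs, unfolded n] transpose_integrated_laplacian
  have form: "x \<bullet> (?L G *\<^sub>v x) = x \<bullet> (?L H *\<^sub>v x) + (z \<bullet> x) * (z \<bullet> x)"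
    if "x \<in> carrier_vec (2 * n)" for x
    using integrated_laplacian_del_arc[OF vs(1) a z_def, unfolded n] assms(6)
    by (intro quadratic_form_rank_one_update[OF L(1) L(1) z that]) simp
  have "nu vs H i \<le> nu vs G i" if "i \<in> {1..2 * n}" for i
  proof -
    have "i - 1 < 2 * n" using that by auto
    then show ?thesis
      \<comment> \<open>No constraint is imposed: the form of \<open>G\<close> exceeds that of
        \<open>H\<close> by a square everywhere, so the index does not shift.\<close>
      using eigenvalues_desc_interlace[OF L L, of "[]" H G "i - 1"] form by (simp add: nu_def)
  qed
  moreover have "nu vs G (i + 1) \<le> nu vs H i" if "i \<in> {1..<2 * n}" for i
  proof -
    have "i - 1 + 1 < 2 * n" "i - 1 + 1 = i" using that by auto
    then show ?thesis
      \<comment> \<open>On vectors orthogonal to \<open>z\<close> the two forms agree, and this one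
        constraint costs a shift by one index. The argument \<open>i - 1\<close> converts the
        numbering from \<open>1\<close> into list positions.\<close>
      using eigenvalues_desc_interlace[OF L L, of "[z]" G H "i - 1"] form z by (simp add: nu_def)
  qed
  ultimately show ?thesis using zero by blast
qed

end
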